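(* For every integer $i\ge 0$, $J(3i+2,\,2i+1)$ is positive and equals the Catalan number $C_i=\frac{1}{i+1}\binom{2i}{i}$.
   Context: Let $\pi=\pi_1\cdots\pi_n$ be a permutation of $[n]$. An entry $\pi_i$ is a left-to-right minimum if $\pi_j>\pi_i$ for all $j<i$. Let the left-to-right minima of $\pi$ be at positions $k_1<k_2<\dots<k_a$ (so $\pi_{k_1}>\dots>\pi_{k_a}$), and set $\pi_{k_0}:=n+1$ and $k_{a+1}:=n+1$. The staircase grid $B_a$ consists of the boxes $(i,j)$ with $1\le i\le j\le a$, where $i$ is the row index counted from the top and $j$ is the column index counted from the left. The staircase encoding of $\pi$ fills box $(i,j)$ of $B_a$ with the number of indices $p$ with $k_j<p<k_{j+1}$ and $\pi_{k_i}<\pi_p<\pi_{k_{i-1}}$. A permutation $\pi$ contains $132$ if there are indices $p<q<r$ with $\pi_p<\pi_r<\pi_q$, and avoids $132$ otherwise. For integers $\ell\ge1$, $k\ge0$, let $J(\ell,k)$ denote the number of $132$-avoiding permutations of $[\ell]$ whose staircase encoding has exactly $k$ nonzero boxes. *)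

theory Defs
  imports Complex_Main "HOL-Combinatorics.Permutations"
begin

text \<open>
  A permutation of \<open>[n]\<close> is a function \<open>\<pi>\<close> with \<open>\<pi> permutes {1..n}\<close>; its \<open>p\<close>-th entry in
  one-line notation is \<open>\<pi> p\<close>.
\<close>

definition contains_132 :: "nat \<Rightarrow> (nat \<Rightarrow> nat) \<Rightarrow> bool" where
  "contains_132 n \<pi> \<longleftrightarrow>
     (\<exists>p\<in>{1..n}. \<exists>q\<in>{1..n}. \<exists>r\<in>{1..n}. p < q \<and> q < r \<and> \<pi> p < \<pi> r \<and> \<pi> r < \<pi> q)"

definition lr_min_positions :: "nat \<Rightarrow> (nat \<Rightarrow> nat) \<Rightarrow> nat set" where
  "lr_min_positions n \<pi> = {i \<in> {1..n}. \<forall>j\<in>{1..<i}. \<pi> j > \<pi> i}"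

definition lr_min_count :: "nat \<Rightarrow> (nat \<Rightarrow> nat) \<Rightarrow> nat" where
  "lr_min_count n \<pi> = card (lr_min_positions n \<pi>)"

text \<open>
  \<open>lr_min_pos n \<pi> j\<close> is \<open>k\<^sub>j\<close> for \<open>1 \<le> j \<le> a + 1\<close>, with \<open>k\<^bsub>a+1\<^esub> = n + 1\<close>. There is no position
  \<open>k\<^sub>0\<close>: only the value \<open>\<pi>\<^bsub>k\<^sub>0\<^esub> = n + 1\<close> is given by convention, as \<open>lr_min_val n \<pi> 0\<close>.
\<close>

definition lr_min_pos :: "nat \<Rightarrow> (nat \<Rightarrow> nat) \<Rightarrow> nat \<Rightarrow> nat" where
  "lr_min_pos n \<pi> j =
     (if 1 \<le> j \<and> j \<le> lr_min_count n \<pi>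
      then sorted_list_of_set (lr_min_positions n \<pi>) ! (j - 1) else n + 1)"

definition lr_min_val :: "nat \<Rightarrow> (nat \<Rightarrow> nat) \<Rightarrow> nat \<Rightarrow> nat" where
  "lr_min_val n \<pi> i = (if i = 0 then n + 1 else \<pi> (lr_min_pos n \<pi> i))"

definition staircase_grid :: "nat \<Rightarrow> (nat \<times> nat) set" where
  "staircase_grid a = {(i, j) \<in> {1..a} \<times> {1..a}. i \<le> j}"

definition staircase_encoding :: "nat \<Rightarrow> (nat \<Rightarrow> nat) \<Rightarrow> nat \<times> nat \<Rightarrow> nat" where
  "staircase_encoding n \<pi> = (\<lambda>(i, j). card {p \<in> {1..n}.
     lr_min_pos n \<pi> j < p \<and> p < lr_min_pos n \<pi> (j + 1) \<and>
     lr_min_val n \<pi> i < \<pi> p \<and> \<pi> p < lr_min_val n \<pi> (i - 1)})"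

definition nonzero_boxes :: "nat \<Rightarrow> (nat \<Rightarrow> nat) \<Rightarrow> (nat \<times> nat) set" where
  "nonzero_boxes n \<pi> =
     {b \<in> staircase_grid (lr_min_count n \<pi>). staircase_encoding n \<pi> b \<noteq> 0}"

definition J :: "nat \<Rightarrow> nat \<Rightarrow> nat" where
  "J l k = card {\<pi>. \<pi> permutes {1..l} \<and> \<not> contains_132 l \<pi> \<and> card (nonzero_boxes l \<pi>) = k}"

end

theory Submission
  imports Defs
begin

text \<open>
  A nonempty 132-avoiding permutation is \<open>L n R\<close> with every entry of \<open>L\<close> above every entry of
  \<open>R\<close>, so 132-avoiding permutations correspond to binary trees. The boxes of \<open>L\<close> and \<open>R\<close> stay
  separate, and for nonempty \<open>L\<close> the entry \<open>n\<close> fills the top right box of \<open>L\<close>, which is new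
  unless it was already nonzero; it was exactly when \<open>L\<close> has at least two entries and ends in its
  maximum. By induction on the tree, \<open>2 n - 3 k \<ge> 1\<close> for \<open>n \<ge> 1\<close> and \<open>k\<close> nonzero boxes, and
  \<open>2 n - 3 k \<ge> 2\<close> if the top right box is zero. The case \<open>(n, k) = (3 i + 2, 2 i + 1)\<close> is
  extremal for the first bound. Tracing equality back through the induction gives the trees
  \<open>Node (thicken s) Leaf\<close> with \<open>s\<close> an arbitrary binary tree of size \<open>i\<close>, and these are counted
  by the Catalan number.
\<close>

section \<open>Catalan numbers and binary trees\<close>

datatype btree = Leaf | Node btree btree

lemma size_0_iff: "size t = 0 \<longleftrightarrow> t = Leaf" for t :: btree
  by (cases t) auto

lemma trees_Suc:
  "{t :: btree. size t = Suc n} =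
     (\<Union>k\<le>n. case_prod Node ` ({t. size t = k} \<times> {t. size t = n - k}))"
proof (rule set_eqI)
  fix t :: btree
  show "t \<in> {t. size t = Suc n} \<longleftrightarrow>
      t \<in> (\<Union>k\<le>n. case_prod Node ` ({t. size t = k} \<times> {t. size t = n - k}))"
    by (cases t) (auto simp: image_iff)
qed

lemma finite_trees: "finite {t :: btree. size t = n}"
proof (induction n rule: less_induct)
  case (less n)
  show ?case
  proof (cases n)
    case 0
    then show ?thesis by (simp add: size_0_iff)
  next
    case (Suc m)
    have "finite {t :: btree. size t = k}" if "k \<le> m" for k
      using less.IH[of k] Suc that by simp
    then show ?thesis
      unfolding Suc trees_Suc by (intro finite_UN_I finite_imageI finite_cartesian_product) auto
  qed
qed

lemma card_trees_Suc:
  "card {t :: btree. size t = Suc n} =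
     (\<Sum>k\<le>n. card {t :: btree. size t = k} * card {t :: btree. size t = n - k})"
proof -
  have "card {t :: btree. size t = Suc n} =
      (\<Sum>k\<le>n. card (case_prod Node ` ({t. size t = k} \<times> {t. size t = n - k})))"
    unfolding trees_Suc by (rule card_UN_disjoint) (auto simp: finite_trees)
  also have "\<dots> = (\<Sum>k\<le>n. card {t :: btree. size t = k} * card {t :: btree. size t = n - k})"
    by (intro sum.cong refl, subst card_image)
       (auto simp: inj_on_def card_cartesian_product)
  finally show ?thesis .
qed

section \<open>The Catalan recurrence in closed form\<close>

abbreviation (input) central_binomial :: "nat \<Rightarrow> real" where
  "central_binomial n \<equiv> real ((2 * n) choose n)"

text \<open>Two uses of the absorption identity, one for each unit added to the upper index, joined
  by the symmetry of row \<open>2 * n + 1\<close>.\<close>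

lemma central_binomial_Suc:
  "central_binomial (Suc n) = central_binomial n * (2 * (2 * real n + 1) / (real n + 1))"
proof -
  have 1: "Suc n * ((2 * Suc n) choose Suc n) = (2 * Suc n) * ((2 * n + 1) choose n)"
    using Suc_times_binomial_eq[of "2 * n + 1" n] by (simp add: mult.commute)
  have 2: "Suc n * ((2 * n + 1) choose n) = (2 * n + 1) * ((2 * n) choose n)"
    using Suc_times_binomial_eq[of "2 * n" n] binomial_symmetric[of n "2 * n + 1"]
    by (simp add: mult.commute)
  have "Suc n * ((2 * Suc n) choose Suc n) = 2 * (Suc n * ((2 * n + 1) choose n))"
    using 1 by simp
  then have "Suc n * ((2 * Suc n) choose Suc n) = 2 * ((2 * n + 1) * ((2 * n) choose n))"
    using 2 by simp
  then have "real (Suc n * ((2 * Suc n) choose Suc n)) =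
      real (2 * ((2 * n + 1) * ((2 * n) choose n)))" by (rule arg_cong)
  then have "(real n + 1) * central_binomial (Suc n) =
      2 * ((2 * real n + 1) * central_binomial n)"
    by (simp add: algebra_simps del: binomial_Suc_Suc mult_Suc_right)
  then show ?thesis by (simp add: field_simps del: binomial_Suc_Suc mult_Suc_right)
qed

text \<open>Gosper's summation algorithm finds the antidifference used here.\<close>

lemma catalan_telescope:
  fixes n :: nat
  defines "G \<equiv> \<lambda>j. central_binomial j * central_binomial (n + 1 - j) * (2 * real j - real n - 1)
                   / (2 * (real n + 1) * (real n + 2))"
  assumes "k \<le> n"
  shows "central_binomial k / (real k + 1) * (central_binomial (n - k) / (real (n - k) + 1)) =
         G (Suc k) - G k"
proof -
  obtain m where n: "n = k + m" using assms(2) le_Suc_ex by blast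
  have e: "n + 1 - Suc k = m" "n + 1 - k = Suc m" "n - k = m" using n by auto
  \<comment> \<open>With \<open>a\<close> for \<open>k\<close>, \<open>c\<close> for
    \<open>n - k\<close> and \<open>x\<close>, \<open>y\<close> for their central binomials, the
    ratio from \<open>central_binomial_Suc\<close> makes every term a multiple of
    \<open>x * y\<close>. What remains is an identity of rational functions in \<open>a\<close> and
    \<open>c\<close>.\<close>
  have alg: "x / (a + 1) * (y / (c + 1)) =
     x * (2 * (2 * a + 1) / (a + 1)) * y * (2 * (1 + a) - (a + c) - 1) / (2 * (a + c + 1) * (a + c + 2))
     - x * (y * (2 * (2 * c + 1) / (c + 1))) * (2 * a - (a + c) - 1) / (2 * (a + c + 1) * (a + c + 2))"
    if "a \<ge> 0" "c \<ge> 0" for x y a c :: real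
  proof -
    have nz: "a + 1 \<noteq> 0" "c + 1 \<noteq> 0" "a + c + 1 \<noteq> 0" "a + c + 2 \<noteq> 0" using that by auto
    have "(2 * (2 * a + 1) / (a + 1)) * (2 * (1 + a) - (a + c) - 1)
          - (2 * (2 * c + 1) / (c + 1)) * (2 * a - (a + c) - 1)
          = 2 * (a + c + 1) * (a + c + 2) / ((a + 1) * (c + 1))"
      using nz by (simp add: divide_simps) algebra
    then have "x * y * ((2 * (2 * a + 1) / (a + 1)) * (2 * (1 + a) - (a + c) - 1)
          - (2 * (2 * c + 1) / (c + 1)) * (2 * a - (a + c) - 1)) / (2 * (a + c + 1) * (a + c + 2))
          = x * y * (2 * (a + c + 1) * (a + c + 2) / ((a + 1) * (c + 1))) / (2 * (a + c + 1) * (a + c + 2))"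
      by simp
    also have "\<dots> = x / (a + 1) * (y / (c + 1))"
      using nz by simp
    finally show ?thesis by (simp add: diff_divide_distrib right_diff_distrib mult_ac)
  qed
  have "real n = real k + real m" using n by simp
  then show ?thesis
    unfolding G_def e central_binomial_Suc of_nat_Suc using alg[of "real k" "real m"] by simp
qed

lemma catalan_convolution:
  "(\<Sum>k\<le>n. central_binomial k / (real k + 1) * (central_binomial (n - k) / (real (n - k) + 1))) =
   central_binomial (Suc n) / (real (Suc n) + 1)"
proof -
  let ?G = "\<lambda>j. central_binomial j * central_binomial (n + 1 - j) * (2 * real j - real n - 1)
                   / (2 * (real n + 1) * (real n + 2))"
  have "(\<Sum>k\<le>n. central_binomial k / (real k + 1) * (central_binomial (n - k) / (real (n - k) + 1)))
      = (\<Sum>k<Suc n. ?G (Suc k) - ?G k)"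
    unfolding lessThan_Suc_atMost by (intro sum.cong refl catalan_telescope) simp
  also have "\<dots> = ?G (Suc n) - ?G 0" by (rule sum_lessThan_telescope)
  \<comment> \<open>The boundary terms are opposite: the binomial product is
    \<open>central_binomial (Suc n)\<close> at both ends, while the linear factor is
    \<open>n + 1\<close> at one end and \<open>- (n + 1)\<close> at the other.\<close>
  also have "\<dots> = central_binomial (Suc n) * (2 * (real n + 1)) / (2 * (real n + 1) * (real n + 2))"
    by (simp add: algebra_simps add_divide_distrib diff_divide_distrib del: binomial_Suc_Suc mult_Suc_right)
  also have "\<dots> = central_binomial (Suc n) / (real (Suc n) + 1)"
  proof -
    have "real n + 1 > 0" by simp
    then show ?thesis by (simp add: add.commute del: binomial_Suc_Suc mult_Suc_right)
  qed
  finally show ?thesis .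
qed

lemma card_trees: "real (card {t :: btree. size t = n}) = central_binomial n / (real n + 1)"
proof (induction n rule: less_induct)
  case (less n)
  show ?case
  proof (cases n)
    case 0
    then show ?thesis by (simp add: size_0_iff)
  next
    case (Suc m)
    have "real (card {t :: btree. size t = Suc m}) =
       (\<Sum>k\<le>m. central_binomial k / (real k + 1) * (central_binomial (m - k) / (real (m - k) + 1)))"
      unfolding card_trees_Suc of_nat_sum of_nat_mult using less Suc
      by (intro sum.cong refl) simp
    then show ?thesis unfolding catalan_convolution Suc .
  qed
qed

section \<open>Words\<close>

text \<open>The marked entry \<open>x\<close> lies before \<open>m\<close>, is \<open>m\<close>, or
  lies after it. All case distinctions for words split at their maximum come from here.\<close>

lemma append_Cons_eq_cases:
  "L @ m # R = u @ x # v \<longleftrightarrow>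
     (\<exists>v'. L = u @ x # v' \<and> v = v' @ m # R) \<or> (u = L \<and> x = m \<and> v = R) \<or>
     (\<exists>u'. u = L @ m # u' \<and> R = u' @ x # v)"
  by (auto simp: append_eq_append_conv2 append_eq_Cons_conv Cons_eq_append_conv)

text \<open>Here \<open>x\<close> plays the 3, \<open>a\<close> the 1 and \<open>b\<close> the 2.
  Splitting the word instead of indexing it makes the notion easy to follow through
  concatenation.\<close>

definition avoids_132 :: "nat list \<Rightarrow> bool" where
  "avoids_132 w \<longleftrightarrow> (\<forall>u x v. w = u @ x # v \<longrightarrow> (\<forall>a\<in>set u. \<forall>b\<in>set v. \<not> (a < b \<and> b < x)))"

text \<open>Minima are kept as values, which do not change when the word becomes part of a longer
  one, whereas positions would shift.\<close>

definition lr_minima :: "nat list \<Rightarrow> nat set" where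
  "lr_minima w = {x. \<exists>u v. w = u @ x # v \<and> (\<forall>y\<in>set u. x < y)}"

text \<open>
  An entry \<open>x\<close> that is not a left-to-right minimum is assigned the pair consisting of the
  minima to its left and the minima below it; this pair determines the box of \<open>x\<close>, with the
  advantage of not referring to positions.
\<close>

definition word_boxes :: "nat list \<Rightarrow> (nat set \<times> nat set) set" where
  "word_boxes w = {(lr_minima u, {m \<in> lr_minima w. m < x}) | u x v.
      w = u @ x # v \<and> (\<exists>y\<in>set u. y < x)}"

lemma lr_minima_subset: "lr_minima w \<subseteq> set w"
  by (auto simp: lr_minima_def)

lemma lr_minima_Nil [simp]: "lr_minima [] = {}"
  by (simp add: lr_minima_def)

lemma lr_minima_Cons: "x \<in> lr_minima (x # w)"
  unfolding lr_minima_def by (auto intro: exI[of _ "[]"])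

lemma lr_minima_empty_iff [simp]: "lr_minima w = {} \<longleftrightarrow> w = []"
  using lr_minima_Cons by (cases w) auto

lemma word_boxes_row_col:
  assumes "(c, r) \<in> word_boxes w"
  shows "c \<subseteq> set w" "c \<noteq> {}" "r \<subseteq> lr_minima w"
proof -
  obtain u x v where b: "c = lr_minima u" "r = {m \<in> lr_minima w. m < x}"
    and w: "w = u @ x # v" and ex: "\<exists>y\<in>set u. y < x"
    using assms unfolding word_boxes_def by blast
  show "c \<subseteq> set w" using lr_minima_subset[of u] unfolding b w by auto
  show "c \<noteq> {}" using ex unfolding b by auto
  show "r \<subseteq> lr_minima w" unfolding b by blast
qed

lemma finite_word_boxes: "finite (word_boxes w)"
proof (rule finite_subset)
  show "word_boxes w \<subseteq> Pow (set w) \<times> Pow (set w)"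
  proof (rule subrelI)
    fix c r assume "(c, r) \<in> word_boxes w"
    then have "c \<subseteq> set w" "r \<subseteq> set w"
      using word_boxes_row_col[of c r w] lr_minima_subset[of w] by auto
    then show "(c, r) \<in> Pow (set w) \<times> Pow (set w)" by simp
  qed
qed simp

text \<open>The shape of a 132-avoiding word around its maximum \<open>m\<close>: an entry of
  \<open>L\<close> smaller than an entry of \<open>R\<close> would form a 132 with \<open>m\<close>
  between them.\<close>

locale max_split =
  fixes L R :: "nat list" and m :: nat
  assumes below: "\<And>x y. x \<in> set R \<Longrightarrow> y \<in> set L \<Longrightarrow> x < y"
    and L_less: "\<And>y. y \<in> set L \<Longrightarrow> y < m"
    and R_less: "\<And>x. x \<in> set R \<Longrightarrow> x < m"
begin

lemma lr_minima_left_eq: "lr_minima (L @ [m]) = (if L = [] then {m} else lr_minima L)"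
proof (cases "L = []")
  case True
  then show ?thesis by (auto simp: lr_minima_def Cons_eq_append_conv)
next
  case False
  then obtain y where "y \<in> set L" by (cases L) auto
  then have "\<not> (\<forall>y\<in>set L. m < y)" using L_less by fastforce
  then show ?thesis using False by (auto simp: lr_minima_def append_Cons_eq_cases)
qed

text \<open>All of \<open>L\<close> and \<open>m\<close> exceed the entries of \<open>R'\<close>, so
  they cannot spoil a minimum there. The form with \<open>R'\<close> also covers prefixes of
  \<open>R\<close>, whose minima give the column sets.\<close>

lemma lr_minima_split:
  assumes "set R' \<subseteq> set R"
  shows "lr_minima (L @ m # R') = lr_minima (L @ [m]) \<union> lr_minima R'"
proof -
  have "lr_minima R' \<subseteq> lr_minima (L @ m # R')"
  proof
    fix x assume "x \<in> lr_minima R'"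
    then obtain u v where "R' = u @ x # v" "\<forall>y\<in>set u. x < y" by (auto simp: lr_minima_def)
    then have "L @ m # R' = (L @ m # u) @ x # v" "\<forall>y\<in>set (L @ m # u). x < y"
      using below R_less assms by auto
    then show "x \<in> lr_minima (L @ m # R')" unfolding lr_minima_def by blast
  qed
  then show ?thesis
    by (auto simp: lr_minima_def append_Cons_eq_cases)
qed

lemma lr_minima_split_disjoint: "lr_minima (L @ [m]) \<inter> set R = {}"
proof -
  have "z \<notin> set R" if "z \<in> set (L @ [m])" for z
    using that below[of z z] R_less[of z] by auto
  then show ?thesis using lr_minima_subset[of "L @ [m]"] by blast
qed

text \<open>Since \<open>R\<close> is below and to the right of \<open>L\<close>, its minima enter
  the row set of every entry of \<open>L\<close>, and the minima of \<open>L @ [m]\<close> enter the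
  column set of every entry of \<open>R\<close>. The middle part is the box of \<open>m\<close>,
  which is itself a minimum when \<open>L\<close> is empty.\<close>

lemma word_boxes_split:
  "word_boxes (L @ m # R) =
     (\<lambda>(c, r). (c, r \<union> lr_minima R)) ` word_boxes L \<union>
     (if L = [] then {} else {(lr_minima L, lr_minima L \<union> lr_minima R)}) \<union>
     (\<lambda>(c, r). (lr_minima (L @ [m]) \<union> c, r)) ` word_boxes R" (is "_ = ?A \<union> ?B \<union> ?C")
proof -
  note split = lr_minima_split[OF subset_refl]
  have rowL: "{z \<in> lr_minima (L @ m # R). z < x} = {z \<in> lr_minima L. z < x} \<union> lr_minima R"
    if "x \<in> set L" for x
  proof -
    have "L \<noteq> []" using that by auto
    moreover have "z < x" if "z \<in> lr_minima R" for z
      using that \<open>x \<in> set L\<close> lr_minima_subset below by blast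
    ultimately show ?thesis unfolding split lr_minima_left_eq by auto
  qed
  have rowm: "{z \<in> lr_minima (L @ m # R). z < m} = lr_minima L \<union> lr_minima R" if "L \<noteq> []"
  proof -
    have "z < m" if "z \<in> lr_minima L \<union> lr_minima R" for z
      using that lr_minima_subset R_less L_less by blast
    then show ?thesis using that unfolding split lr_minima_left_eq by auto
  qed
  have rowR: "{z \<in> lr_minima (L @ m # R). z < x} = {z \<in> lr_minima R. z < x}" if "x \<in> set R" for x
  proof -
    have "x < z" if "z \<in> lr_minima (L @ [m])" for z
      using that \<open>x \<in> set R\<close> lr_minima_subset[of "L @ [m]"] below R_less by auto
    then show ?thesis unfolding split by force
  qed
  have col: "lr_minima (L @ m # u) = lr_minima (L @ [m]) \<union> lr_minima u" if "R = u @ x # v" for u x v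
    using that by (intro lr_minima_split) auto
  \<comment> \<open>Whether an entry of \<open>R\<close> is a minimum is decided inside
    \<open>R\<close>, as \<open>L\<close> and \<open>m\<close> exceed it.\<close>
  have cond: "(\<exists>y\<in>set (L @ m # u). y < x) \<longleftrightarrow> (\<exists>y\<in>set u. y < x)" if "R = u @ x # v" for u x v
    using that below[of x] R_less[of x] by fastforce
  show ?thesis
  proof (intro equalityI subsetI)
    fix b assume "b \<in> word_boxes (L @ m # R)"
    then obtain u x v where b: "b = (lr_minima u, {z \<in> lr_minima (L @ m # R). z < x})"
      and w: "L @ m # R = u @ x # v" and ex: "\<exists>y\<in>set u. y < x"
      unfolding word_boxes_def by blast
    consider v' where "L = u @ x # v'" | "u = L" "x = m" | u' where "u = L @ m # u'" "R = u' @ x # v"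
      using w unfolding append_Cons_eq_cases by blast
    then show "b \<in> ?A \<union> ?B \<union> ?C"
    proof cases
      case 1
      have "x \<in> set L" using 1 by simp
      have "(lr_minima u, {z \<in> lr_minima L. z < x}) \<in> word_boxes L"
        using 1 ex unfolding word_boxes_def by blast
      then have "b \<in> ?A" unfolding b rowL[OF \<open>x \<in> set L\<close>] by (rule rev_image_eqI) simp
      then show ?thesis by blast
    next
      case 2
      then have "L \<noteq> []" using ex by auto
      then show ?thesis using 2 rowm b by simp
    next
      case 3
      have "\<exists>y\<in>set u'. y < x" using ex cond[OF 3(2)] unfolding 3(1) by blast
      then have "(lr_minima u', {z \<in> lr_minima R. z < x}) \<in> word_boxes R"
        using 3(2) unfolding word_boxes_def by blast
      moreover have "x \<in> set R" using 3 by simp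
      ultimately have "b \<in> ?C"
        unfolding b rowR[OF \<open>x \<in> set R\<close>] 3(1) col[OF 3(2)] by (intro rev_image_eqI) auto
      then show ?thesis by blast
    qed
  next
    fix b assume "b \<in> ?A \<union> ?B \<union> ?C"
    then consider "b \<in> ?A" | "b \<in> ?B" | "b \<in> ?C" by blast
    then show "b \<in> word_boxes (L @ m # R)"
    proof cases
      case 1
      then obtain c r where "(c, r) \<in> word_boxes L" "b = (c, r \<union> lr_minima R)" by auto
      then obtain u x v where b: "b = (lr_minima u, {z \<in> lr_minima L. z < x} \<union> lr_minima R)"
        and L: "L = u @ x # v" and ex: "\<exists>y\<in>set u. y < x" unfolding word_boxes_def by blast
      have "x \<in> set L" using L by simp
      moreover have "L @ m # R = u @ x # (v @ m # R)" using L by simp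
      ultimately show ?thesis
        using ex unfolding b rowL[OF \<open>x \<in> set L\<close>, symmetric] word_boxes_def by blast
    next
      case 2
      then have ne: "L \<noteq> []" and b: "b = (lr_minima L, lr_minima L \<union> lr_minima R)"
        by (auto split: if_splits)
      have "\<exists>y\<in>set L. y < m" using ne L_less by (cases L) auto
      then show ?thesis unfolding b rowm[OF ne, symmetric] word_boxes_def by blast
    next
      case 3
      then obtain c r where "(c, r) \<in> word_boxes R" "b = (lr_minima (L @ [m]) \<union> c, r)" by auto
      then obtain u x v where b: "b = (lr_minima (L @ [m]) \<union> lr_minima u, {z \<in> lr_minima R. z < x})"
        and R: "R = u @ x # v" and ex: "\<exists>y\<in>set u. y < x" unfolding word_boxes_def by blast
      have "x \<in> set R" using R by simp
      moreover have "L @ m # R = (L @ m # u) @ x # v" using R by simp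
      moreover have "\<exists>y\<in>set (L @ m # u). y < x" using ex by auto
      ultimately show ?thesis unfolding b rowR[OF \<open>x \<in> set R\<close>, symmetric] col[OF R, symmetric] word_boxes_def
        by blast
    qed
  qed
qed

text \<open>The minima added to the boxes of either side are disjoint from those already present, so
  both maps are injective. Only the box of \<open>m\<close> can coincide with another one, namely
  with the top right box of \<open>L\<close>, whose entries have all minima of \<open>L\<close>
  before and below them.\<close>

lemma card_word_boxes_split:
  "card (word_boxes (L @ m # R)) = card (word_boxes L) + card (word_boxes R) +
     (if L \<noteq> [] \<and> (lr_minima L, lr_minima L) \<notin> word_boxes L then 1 else 0)"
proof -
  let ?f = "\<lambda>(c, r). (c, r \<union> lr_minima R)"
  let ?g = "\<lambda>(c, r). (lr_minima (L @ [m]) \<union> c, r)"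
  let ?B = "if L = [] then {} else {(lr_minima L, lr_minima L \<union> lr_minima R)}"
  have disj: "lr_minima L \<inter> lr_minima R = {}"
    using lr_minima_subset[of R] lr_minima_subset[of L] below by fastforce
  have rowL: "r \<inter> lr_minima R = {}" if "(c, r) \<in> word_boxes L" for c r
    using word_boxes_row_col(3)[OF that] disj by blast
  have "inj_on ?f (word_boxes L)"
    unfolding inj_on_def using rowL by (auto; blast)
  then have cA: "card (?f ` word_boxes L) = card (word_boxes L)" by (rule card_image)
  have "c \<inter> lr_minima (L @ [m]) = {}" if "(c, r) \<in> word_boxes R" for c r
    using word_boxes_row_col(1)[OF that] lr_minima_split_disjoint by blast
  then have "inj_on ?g (word_boxes R)"
    unfolding inj_on_def by (auto; blast)
  then have cC: "card (?g ` word_boxes R) = card (word_boxes R)" by (rule card_image)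
  \<comment> \<open>The column set of a box from \<open>R\<close> contains a value of
    \<open>R\<close>; those of the other boxes lie within \<open>set L\<close>.\<close>
  have "(?f ` word_boxes L \<union> ?B) \<inter> ?g ` word_boxes R = {}"
  proof (rule ccontr)
    assume "\<not> ?thesis"
    then obtain c r c' where "(c, r) \<in> word_boxes R"
      and c': "lr_minima (L @ [m]) \<union> c = c'" and "c' \<subseteq> set L"
      using word_boxes_row_col(1)[of _ _ L] lr_minima_subset[of L]
      by (fastforce split: if_splits)
    then have "c \<subseteq> set R" "c \<noteq> {}" "c \<subseteq> set L" using word_boxes_row_col by blast+
    then show False using below by fastforce
  qed
  then have "card (word_boxes (L @ m # R)) = card (?f ` word_boxes L \<union> ?B) + card (?g ` word_boxes R)"
    unfolding word_boxes_split by (intro card_Un_disjoint) (auto simp: finite_word_boxes)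
  also have "card (?f ` word_boxes L \<union> ?B) = card (word_boxes L) +
      (if L \<noteq> [] \<and> (lr_minima L, lr_minima L) \<notin> word_boxes L then 1 else 0)"
  proof (cases "L = []")
    case True
    then show ?thesis using cA by simp
  next
    case False
    have "(lr_minima L, lr_minima L \<union> lr_minima R) \<in> ?f ` word_boxes L \<longleftrightarrow>
          (lr_minima L, lr_minima L) \<in> word_boxes L"
    proof
      assume "(lr_minima L, lr_minima L \<union> lr_minima R) \<in> ?f ` word_boxes L"
      then obtain r where r: "(lr_minima L, r) \<in> word_boxes L"
        "lr_minima L \<union> lr_minima R = r \<union> lr_minima R" by auto
      then have "r = lr_minima L" using rowL[OF r(1)] disj by blast
      then show "(lr_minima L, lr_minima L) \<in> word_boxes L" using r by simp
    next
      assume "(lr_minima L, lr_minima L) \<in> word_boxes L"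
      then show "(lr_minima L, lr_minima L \<union> lr_minima R) \<in> ?f ` word_boxes L"
        by (rule rev_image_eqI) simp
    qed
    then show ?thesis using False cA by (auto simp: finite_word_boxes insert_absorb)
  qed
  finally show ?thesis unfolding cC by simp
qed

text \<open>An entry in the top right box comes after all minima and exceeds them all. Entries of
  \<open>L\<close> and \<open>m\<close> come before the minima of \<open>R\<close>, so
  \<open>R\<close> must be empty; entries of \<open>R\<close> are smaller than the minima of
  \<open>L @ [m]\<close>. Conversely \<open>m\<close> fills the box.\<close>

lemma full_box_split:
  "(lr_minima (L @ m # R), lr_minima (L @ m # R)) \<in> word_boxes (L @ m # R) \<longleftrightarrow> L \<noteq> [] \<and> R = []"
  (is "(?M, ?M) \<in> _ \<longleftrightarrow> _")
proof
  note split = lr_minima_split[OF subset_refl]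
  show "(?M, ?M) \<in> word_boxes (L @ m # R)" if "L \<noteq> [] \<and> R = []"
    unfolding word_boxes_split using that lr_minima_left_eq by simp
  have ne: "lr_minima (L @ [m]) \<noteq> {}" by simp
  assume "(?M, ?M) \<in> word_boxes (L @ m # R)"
  then consider c r where "(c, r) \<in> word_boxes L" "?M = c"
    | "L \<noteq> []" "?M = lr_minima L" | c r where "(c, r) \<in> word_boxes R" "?M = r"
    unfolding word_boxes_split by (auto split: if_splits)
  then show "L \<noteq> [] \<and> R = []"
  proof cases
    case 1
    then have "lr_minima R \<subseteq> set L" "L \<noteq> []"
      using word_boxes_row_col[OF 1(1)] split by auto
    then have "lr_minima R = {}" using lr_minima_subset[of R] below by fastforce
    then show ?thesis using \<open>L \<noteq> []\<close> by simp
  next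
    case 2
    then have "lr_minima R = {}" using split lr_minima_subset[of R] lr_minima_subset[of L] below
      by fastforce
    then show ?thesis using 2 by simp
  next
    case 3
    then have "lr_minima (L @ [m]) \<subseteq> set R"
      using word_boxes_row_col(3)[OF 3(1)] split lr_minima_subset[of R] by blast
    then show ?thesis using lr_minima_split_disjoint ne by blast
  qed
qed

text \<open>No pattern crosses the split: a 1 in \<open>L\<close> forces the 2 out of
  \<open>R\<close>, and \<open>m\<close> can play neither 1 nor 2 and plays the 3 only with 1 in
  \<open>L\<close> and 2 in \<open>R\<close>.\<close>

lemma avoids_132_split: "avoids_132 (L @ m # R) \<longleftrightarrow> avoids_132 L \<and> avoids_132 R"
proof
  assume av: "avoids_132 (L @ m # R)"
  show "avoids_132 L \<and> avoids_132 R"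
    unfolding avoids_132_def
  proof (intro conjI allI impI)
    fix u x v assume "L = u @ x # v"
    then show "\<forall>a\<in>set u. \<forall>b\<in>set v. \<not> (a < b \<and> b < x)"
      using av[unfolded avoids_132_def, rule_format, of u x "v @ m # R"] by auto
  next
    fix u x v assume "R = u @ x # v"
    then show "\<forall>a\<in>set u. \<forall>b\<in>set v. \<not> (a < b \<and> b < x)"
      using av[unfolded avoids_132_def, rule_format, of "L @ m # u" x v] by auto
  qed
next
  assume av: "avoids_132 L \<and> avoids_132 R"
  show "avoids_132 (L @ m # R)"
    unfolding avoids_132_def
  proof (intro allI impI ballI)
    fix u x v a b assume w: "L @ m # R = u @ x # v" and ab: "a \<in> set u" "b \<in> set v"
    consider v' where "L = u @ x # v'" "v = v' @ m # R" | "u = L" "x = m" "v = R"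
      | u' where "u = L @ m # u'" "R = u' @ x # v"
      using w unfolding append_Cons_eq_cases by blast
    then show "\<not> (a < b \<and> b < x)"
    proof cases
      case 1
      then have "a \<in> set L" "x \<in> set L" using ab by auto
      moreover have "\<not> (a < b \<and> b < x)" if "b \<in> set v'"
        using av 1(1) ab(1) that unfolding avoids_132_def by blast
      ultimately show ?thesis using ab(2) below L_less unfolding 1(2) by fastforce
    next
      case 2
      then show ?thesis using ab below by fastforce
    next
      case 3
      then have "b \<in> set R" using ab by auto
      moreover have "\<not> (a < b \<and> b < x)" if "a \<in> set u'"
        using av 3(2) ab(2) that unfolding avoids_132_def by blast
      ultimately show ?thesis using ab(1) below R_less unfolding 3(1) by fastforce
    qed
  qed
qed

end

section \<open>Trees and 132-avoiding words\<close>

text \<open>A 132-avoiding word with greatest entry \<open>m\<close> is \<open>L m R\<close> with every entry of \<open>L\<close> above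
  every entry of \<open>R\<close>. The argument \<open>d\<close> shifts all values.\<close>

fun word_of :: "nat \<Rightarrow> btree \<Rightarrow> nat list" where
  "word_of d Leaf = []"
| "word_of d (Node l r) = word_of (d + size r) l @ (d + size l + size r + 1) # word_of d r"

lemma length_word_of [simp]: "length (word_of d t) = size t"
  by (induction t arbitrary: d) auto

lemma set_word_of: "set (word_of d t) = {d<..d + size t}"
  by (induction t arbitrary: d) auto

lemma word_of_Nil_iff [simp]: "word_of d t = [] \<longleftrightarrow> t = Leaf"
  by (cases t) auto

lemma max_split_word_of:
  "max_split (word_of (d + size r) l) (word_of d r) (d + size l + size r + 1)"
  by unfold_locales (auto simp: set_word_of)

lemma avoids_132_word_of: "avoids_132 (word_of d t)"
proof (induction t arbitrary: d)
  case Leaf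
  then show ?case by (simp add: avoids_132_def)
next
  case (Node l r)
  then show ?case using max_split.avoids_132_split[OF max_split_word_of] by simp
qed

lemma word_of_inj: "word_of d t = word_of d t' \<Longrightarrow> t = t'"
proof (induction t arbitrary: d t')
  case Leaf
  then show ?case by (metis word_of_Nil_iff)
next
  case (Node l r)
  obtain l' r' where t': "t' = Node l' r'" using Node.prems by (cases t') auto
  let ?m = "d + size l + size r + 1"
  \<comment> \<open>Equal lengths give both words the same maximum; it occurs only once, so the two
    splits agree.\<close>
  have "size (Node l r) = size t'" using arg_cong[OF Node.prems, of length] by simp
  then have eq: "word_of (d + size r) l @ ?m # word_of d r = word_of (d + size r') l' @ ?m # word_of d r'"
    using Node.prems t' by (simp add: add.assoc)
  have "?m \<notin> set (word_of (d + size r) l)" "?m \<notin> set (word_of d r)"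
    by (auto simp: set_word_of)
  then have l: "word_of (d + size r) l = word_of (d + size r') l'" and r: "word_of d r = word_of d r'"
    using eq unfolding append_Cons_eq_cases by auto
  \<comment> \<open>The right subtrees come first, because the shift of the left word depends on
    \<open>size r\<close>.\<close>
  have "r = r'" using Node.IH(2)[OF r] .
  moreover from this have "l = l'" using Node.IH(1) l by blast
  ultimately show ?case using t' by simp
qed

text \<open>Avoidance puts the values of \<open>R\<close> below those of \<open>L\<close>, so each
  side fills an interval and the induction hypothesis applies with shifts \<open>d\<close> and
  \<open>d + length R\<close>.\<close>

lemma word_of_surj:
  assumes "distinct w" "set w = {d<..d + length w}" "avoids_132 w"
  shows "\<exists>t. w = word_of d t"
  using assms
proof (induction "length w" arbitrary: w d rule: less_induct)
  case less
  show ?case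
  proof (cases "w = []")
    case True
    then show ?thesis by (metis word_of.simps(1))
  next
    case False
    define m where "m = d + length w"
    have "m \<in> set w" using less.prems(2) False by (simp add: m_def)
    then obtain L R where w: "w = L @ m # R" by (meson split_list)
    have mLR: "m \<notin> set L" "m \<notin> set R" and disj: "set L \<inter> set R = {}"
      and dist: "distinct L" "distinct R"
      using less.prems(1) unfolding w by auto
    have "insert m (set L \<union> set R) = {d<..m}"
      using less.prems(2) unfolding m_def[symmetric] unfolding w by simp
    then have "set L \<union> set R = {d<..m} - {m}" using mLR by blast
    also have "\<dots> = {d<..<m}" by auto
    finally have LR: "set L \<union> set R = {d<..<m}" .
    have in_range: "d < x \<and> x < m" if "x \<in> set L \<or> x \<in> set R" for x
    proof -
      have "x \<in> set L \<union> set R" using that by simp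
      then show ?thesis unfolding LR by simp
    qed
    have below: "x < y" if "x \<in> set R" "y \<in> set L" for x y
    proof -
      \<comment> \<open>Otherwise \<open>y\<close>, \<open>m\<close>, \<open>x\<close> would form a
        132.\<close>
      have "\<not> (y < x \<and> x < m)"
        using less.prems(3) that unfolding avoids_132_def w by blast
      moreover have "x \<noteq> y" using that disj by blast
      ultimately show ?thesis using in_range that by auto
    qed
    interpret max_split L R m
    proof
      show "x < y" if "x \<in> set R" "y \<in> set L" for x y using below that .
      show "y < m" if "y \<in> set L" for y using in_range that by blast
      show "x < m" if "x \<in> set R" for x using in_range that by blast
    qed
    have len: "length w = length L + length R + 1" using arg_cong[OF w, of length] by simp
    have cR: "card (set R) = length R" using dist distinct_card by blast
    have setR: "set R = {d<..d + length R}"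
    proof (cases "R = []")
      case True
      then show ?thesis by simp
    next
      case False
      let ?M = "Max (set R)"
      have M: "?M \<in> set R" using False by simp
      \<comment> \<open>A value below the maximum of \<open>R\<close> cannot belong to
        \<open>L\<close>. The length of \<open>R\<close> then fixes the right end of the
        interval.\<close>
      have "set R = {d<..?M}"
      proof (intro equalityI subsetI)
        fix x assume "x \<in> set R"
        then show "x \<in> {d<..?M}" using in_range by simp
      next
        fix x assume x: "x \<in> {d<..?M}"
        moreover have "?M < m" using M in_range by blast
        ultimately have "x \<in> set L \<union> set R" unfolding LR by simp
        then show "x \<in> set R" using below[OF M, of x] x by auto
      qed
      moreover from this have "length R = ?M - d" using cR card_greaterThanAtMost by metis
      moreover have "d < ?M" using M in_range by blast
      ultimately show ?thesis by simp
    qed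
    have setL: "set L = {d + length R<..(d + length R) + length L}"
    proof -
      have "set L = {d<..<m} - set R" unfolding LR[symmetric] using disj by blast
      also have "\<dots> = {d + length R<..<d + (length L + length R + 1)}"
        unfolding setR m_def len by auto
      also have "\<dots> = {d + length R<..(d + length R) + length L}" by auto
      finally show ?thesis .
    qed
    have av: "avoids_132 L" "avoids_132 R" using less.prems(3) unfolding w avoids_132_split by blast+
    obtain l where l: "L = word_of (d + length R) l"
      using less.hyps[OF _ dist(1) setL av(1)] unfolding len by auto
    obtain r where r: "R = word_of d r"
      using less.hyps[OF _ dist(2) setR av(2)] unfolding len by auto
    have sz: "length R = size r" "length L = size l" using l r by simp_all
    then have "m = d + size l + size r + 1" using len by (simp add: m_def)
    then have "w = word_of d (Node l r)" using w l r sz by simp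
    then show ?thesis by blast
  qed
qed

section \<open>Box count of a tree\<close>

text \<open>\<open>full_box t\<close> says that the box in the top right corner of the staircase is nonzero.\<close>

definition full_box :: "btree \<Rightarrow> bool" where
  "full_box t \<longleftrightarrow> (\<exists>l. t = Node l Leaf \<and> l \<noteq> Leaf)"

fun box_count :: "btree \<Rightarrow> nat" where
  "box_count Leaf = 0"
| "box_count (Node l r) =
     box_count l + box_count r + (if l \<noteq> Leaf \<and> \<not> full_box l then 1 else 0)"

lemma full_box_word_of:
  "(lr_minima (word_of d t), lr_minima (word_of d t)) \<in> word_boxes (word_of d t) \<longleftrightarrow> full_box t"
proof (cases t)
  case Leaf
  then show ?thesis by (simp add: full_box_def word_boxes_def)
next
  case (Node l r)
  then show ?thesis
    using max_split.full_box_split[OF max_split_word_of] by (simp add: full_box_def) blast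
qed

lemma card_word_boxes_word_of: "card (word_boxes (word_of d t)) = box_count t"
proof (induction t arbitrary: d)
  case Leaf
  then show ?case by (simp add: word_boxes_def)
next
  case (Node l r)
  then show ?case
    using max_split.card_word_boxes_split[OF max_split_word_of] by (simp add: full_box_word_of)
qed

text \<open>Call \<open>2 * size t - 3 * box_count t\<close> the slack. The root adds 2 and a new
  box costs 3, but a new box requires a left subtree that is not full, which has slack at least 2.
  This leaves 1 if the right subtree is empty, the full case; otherwise the right subtree adds at
  least 1 more.\<close>

lemma box_count_bound:
  "t \<noteq> Leaf \<Longrightarrow> 3 * box_count t + (if full_box t then 1 else 2) \<le> 2 * size t"
proof (induction t)
  case (Node l r)
  have full: "full_box (Node l r) \<longleftrightarrow> r = Leaf \<and> l \<noteq> Leaf" by (auto simp: full_box_def)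
  have l: "3 * box_count l + (if full_box l then 1 else 2) \<le> 2 * size l" if "l \<noteq> Leaf"
    using Node.IH(1) that .
  have r: "3 * box_count r + 1 \<le> 2 * size r" if "r \<noteq> Leaf"
    using Node.IH(2)[OF that] by (simp split: if_splits)
  show ?case
  proof (cases "l = Leaf")
    case True
    then show ?thesis using r full by (cases "r = Leaf") simp_all
  next
    case False
    then show ?thesis using l[OF False] r full by (cases "r = Leaf"; cases "full_box l") simp_all
  qed
qed simp

text \<open>Parametrizes the nonempty trees that are not full and have slack exactly 2. Each leaf
  becomes one node; each inner node becomes two nodes, and each of these contributes a box.\<close>

fun thicken :: "btree \<Rightarrow> btree" where
  "thicken Leaf = Node Leaf Leaf"
| "thicken (Node s t) = Node (thicken s) (Node (thicken t) Leaf)"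

lemma thicken_not_Leaf [simp]: "thicken s \<noteq> Leaf"
  by (cases s) auto

lemma full_box_thicken [simp]: "\<not> full_box (thicken s)"
  by (cases s) (auto simp: full_box_def)

lemma size_thicken [simp]: "size (thicken s) = 3 * size s + 1"
  by (induction s) auto

lemma box_count_thicken [simp]: "box_count (thicken s) = 2 * size s"
  by (induction s) auto

lemma thicken_inj: "thicken s = thicken t \<Longrightarrow> s = t"
proof (induction s arbitrary: t)
  case Leaf
  then show ?case by (cases t) auto
next
  case (Node s1 s2)
  then show ?case by (cases t) auto
qed

text \<open>By \<open>box_count_bound\<close> slack 1 forces a full box, hence an empty right
  subtree. A full \<open>l\<close> would add no box at the root and leave slack at least 3.\<close>

lemma box_count_extremal_1:
  assumes "2 * size t = 3 * box_count t + 1"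
  shows "\<exists>l. t = Node l Leaf \<and> l \<noteq> Leaf \<and> \<not> full_box l \<and> 2 * size l = 3 * box_count l + 2"
proof -
  have "t \<noteq> Leaf" using assms by auto
  then have "full_box t" using box_count_bound[of t] assms by (auto split: if_splits)
  then obtain l where l: "t = Node l Leaf" "l \<noteq> Leaf" by (auto simp: full_box_def)
  then show ?thesis using box_count_bound[of l] assms by (auto split: if_splits)
qed

text \<open>Equality in each case of \<open>box_count_bound\<close> leaves either a single node or
  exactly the shape of the recursive clause of \<open>thicken\<close>.\<close>

lemma box_count_extremal_2:
  assumes "t \<noteq> Leaf" "\<not> full_box t" "2 * size t = 3 * box_count t + 2"
  shows "t \<in> range thicken"
  using assms
proof (induction "size t" arbitrary: t rule: less_induct)
  case less
  obtain l r where t: "t = Node l r" using less.prems by (cases t) auto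
  show ?case
  proof (cases "l = Leaf")
    case True
    then have "2 * size r = 3 * box_count r" using less.prems(3) t by simp
    then have "r = Leaf" using box_count_bound[of r] by (cases "full_box r"; cases "r = Leaf") auto
    then show ?thesis using True t by (metis thicken.simps(1) rangeI)
  next
    case False
    have "r \<noteq> Leaf" using False less.prems(2) t by (auto simp: full_box_def)
    \<comment> \<open>A full \<open>l\<close> would give slack at least \<open>2 + 1 + 1\<close>.
      Otherwise the slack is at least \<open>2 - 3 + 2 + 1 = 2\<close>, so both subtrees attain
      their bounds.\<close>
    then have bounds: "\<not> full_box l" "2 * size l = 3 * box_count l + 2" "2 * size r = 3 * box_count r + 1"
      using box_count_bound[OF False] box_count_bound[OF \<open>r \<noteq> Leaf\<close>] False less.prems(3) unfolding t
      by (cases "full_box l"; cases "full_box r"; simp)+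
    obtain r' where r': "r = Node r' Leaf" "r' \<noteq> Leaf" "\<not> full_box r'" "2 * size r' = 3 * box_count r' + 2"
      using box_count_extremal_1[OF bounds(3)] by blast
    have "l \<in> range thicken" "r' \<in> range thicken"
      using less.hyps[of l] less.hyps[of r'] bounds(1,2) False r' unfolding t by simp_all
    then obtain a b where "l = thicken a" "r' = thicken b" by blast
    then have "t = thicken (Node a b)" using t r'(1) by simp
    then show ?thesis by blast
  qed
qed

lemma extremal_trees:
  "{t. size t = 3 * i + 2 \<and> box_count t = 2 * i + 1} = (\<lambda>s. Node (thicken s) Leaf) ` {s. size s = i}"
proof (intro equalityI subsetI)
  fix t assume "t \<in> {t. size t = 3 * i + 2 \<and> box_count t = 2 * i + 1}"
  \<comment> \<open>Both sides equal \<open>6 * i + 4\<close>, so these parameters have slack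
    1.\<close>
  then have t: "size t = 3 * i + 2" "2 * size t = 3 * box_count t + 1" by simp_all
  obtain l where l: "t = Node l Leaf" "l \<in> range thicken"
    using box_count_extremal_1[OF t(2)] box_count_extremal_2 by metis
  then obtain s where s: "t = Node (thicken s) Leaf" by blast
  then have "size s = i" using t(1) by simp
  then show "t \<in> (\<lambda>s. Node (thicken s) Leaf) ` {s. size s = i}" using s by blast
next
  fix t assume "t \<in> (\<lambda>s. Node (thicken s) Leaf) ` {s. size s = i}"
  then show "t \<in> {t. size t = 3 * i + 2 \<and> box_count t = 2 * i + 1}" by auto
qed

section \<open>The staircase encoding\<close>

lemma mem_down_set_iff:
  fixes I :: "nat set"
  assumes "finite I" and down: "\<And>t t'. t \<in> I \<Longrightarrow> t' < t \<Longrightarrow> t' \<in> I"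
  shows "j \<in> I \<longleftrightarrow> j < card I"
proof
  assume "j \<in> I"
  then have "{..j} \<subseteq> I" using down by (auto simp: le_less)
  then have "card {..j} \<le> card I" using assms(1) card_mono by blast
  then show "j < card I" by simp
next
  assume "j < card I"
  moreover have "card I \<le> j" if "j \<notin> I"
  proof -
    have "t < j" if "t \<in> I" for t
      using that \<open>j \<notin> I\<close> down by (metis linorder_neqE_nat)
    then have "I \<subseteq> {..<j}" by auto
    then show ?thesis using card_mono[of "{..<j}" I] by simp
  qed
  ultimately show "j \<in> I" by fastforce
qed

text \<open>An initial segment \<open>X\<close> of \<open>A\<close> occupies the first
  \<open>card X\<close> places of the sorted list. This turns comparisons with the
  \<open>j\<close>-th minimum into comparisons of \<open>j\<close> with a cardinality.\<close>

lemma sorted_list_of_set_nth_mem_iff: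
  fixes A :: "nat set"
  assumes "finite A" "X \<subseteq> A" "\<And>x y. x \<in> X \<Longrightarrow> y \<in> A \<Longrightarrow> y < x \<Longrightarrow> y \<in> X" "j < card A"
  shows "sorted_list_of_set A ! j \<in> X \<longleftrightarrow> j < card X"
proof -
  let ?s = "sorted_list_of_set A"
  let ?I = "{t. t < card A \<and> ?s ! t \<in> X}"
  have sA: "set ?s = A" "length ?s = card A" "distinct ?s" using assms(1) by auto
  have less: "?s ! t < ?s ! t'" if "t < t'" "t' < card A" for t t'
    using that sA strict_sorted_list_of_set[of A] by (simp add: sorted_wrt_iff_nth_less)
  have "bij_betw ((!) ?s) ?I X"
    unfolding bij_betw_def
  proof
    show "inj_on ((!) ?s) ?I" using sA by (auto simp: inj_on_def nth_eq_iff_index_eq)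
    have "\<exists>t<card A. x = ?s ! t" if "x \<in> X" for x
      using that assms(2) sA by (metis in_set_conv_nth subsetD)
    then show "(!) ?s ` ?I = X" by blast
  qed
  then have card: "card ?I = card X" by (rule bij_betw_same_card)
  have fin: "finite ?I" by simp
  have down: "t' \<in> ?I" if "t \<in> ?I" "t' < t" for t t'
  proof -
    have "?s ! t' \<in> A" using that sA nth_mem[of t' ?s] by auto
    then show ?thesis using that less[of t' t] assms(3)[of "?s ! t" "?s ! t'"] by simp
  qed
  have "j \<in> ?I \<longleftrightarrow> j < card ?I" using fin down by (rule mem_down_set_iff)
  then have "j \<in> ?I \<longleftrightarrow> j < card X" using card by auto
  then show ?thesis using assms(4) by simp
qed

text \<open>Lets two labellings of the same boxes be compared without writing a translation between
  the labels.\<close>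

lemma card_image_eq_if_same_fibres:
  assumes "\<And>p q. p \<in> A \<Longrightarrow> q \<in> A \<Longrightarrow> f p = f q \<longleftrightarrow> g p = g q"
  shows "card (f ` A) = card (g ` A)"
proof (rule bij_betw_same_card)
  show "bij_betw (\<lambda>y. g (inv_into A f y)) (f ` A) (g ` A)"
    unfolding bij_betw_def
  proof
    have *: "g (inv_into A f (f p)) = g p" if "p \<in> A" for p
      using assms[of "inv_into A f (f p)" p] that by (simp add: f_inv_into_f inv_into_into)
    then show "inj_on (\<lambda>y. g (inv_into A f y)) (f ` A)"
      using assms by (auto simp: inj_on_def)
    show "(\<lambda>y. g (inv_into A f y)) ` f ` A = g ` A"
      using * by (auto simp: image_image)
  qed
qed

section \<open>Permutations as words\<close>

definition word :: "nat \<Rightarrow> (nat \<Rightarrow> nat) \<Rightarrow> nat list" where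
  "word n \<pi> = map \<pi> [1..<Suc n]"

lemma upt_split:
  assumes "p \<in> {1..n}"
  shows "[1..<Suc n] = [1..<p] @ p # [Suc p..<Suc n]"
proof -
  have "[1..<Suc n] = [1..<p] @ [p..<Suc n]"
    using assms upt_add_eq_append[of 1 p "Suc n - p"] by simp
  also have "[p..<Suc n] = p # [Suc p..<Suc n]"
    using assms by (intro upt_conv_Cons) simp
  finally show ?thesis .
qed

lemma word_eq_append_Cons_iff:
  "word n \<pi> = u @ x # v \<longleftrightarrow>
     (\<exists>p\<in>{1..n}. u = map \<pi> [1..<p] \<and> x = \<pi> p \<and> v = map \<pi> [Suc p..<Suc n])"
proof
  assume w: "word n \<pi> = u @ x # v"
  let ?p = "Suc (length u)"
  have "length (word n \<pi>) = n" by (simp add: word_def)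
  then have p: "?p \<in> {1..n}" using arg_cong[OF w, of length] by simp
  then have "[1..<Suc n] = [1..<?p] @ ?p # [Suc ?p..<Suc n]"
    by (rule upt_split)
  then have "word n \<pi> = map \<pi> [1..<?p] @ \<pi> ?p # map \<pi> [Suc ?p..<Suc n]"
    by (simp only: word_def map_append list.map)
  then have eq: "u @ x # v = map \<pi> [1..<?p] @ \<pi> ?p # map \<pi> [Suc ?p..<Suc n]" using w by simp
  have len: "length u = length (map \<pi> [1..<?p])" by (simp del: upt_Suc)
  have "u = map \<pi> [1..<?p] \<and> x # v = \<pi> ?p # map \<pi> [Suc ?p..<Suc n]"
    using iffD1[OF append_eq_append_conv[OF disjI1[OF len]] eq] .
  then have "u = map \<pi> [1..<?p] \<and> x = \<pi> ?p \<and> v = map \<pi> [Suc ?p..<Suc n]"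
    unfolding list.inject .
  then show "\<exists>p\<in>{1..n}. u = map \<pi> [1..<p] \<and> x = \<pi> p \<and> v = map \<pi> [Suc p..<Suc n]"
    using p by blast
next
  assume "\<exists>p\<in>{1..n}. u = map \<pi> [1..<p] \<and> x = \<pi> p \<and> v = map \<pi> [Suc p..<Suc n]"
  then obtain p where p: "p \<in> {1..n}" "u = map \<pi> [1..<p]" "x = \<pi> p" "v = map \<pi> [Suc p..<Suc n]"
    by blast
  have "[1..<Suc n] = [1..<p] @ p # [Suc p..<Suc n]"
    using p(1) by (rule upt_split)
  then show "word n \<pi> = u @ x # v"
    unfolding p by (simp only: word_def map_append list.map)
qed

lemma set_word_prefix: "set (map \<pi> [1..<p]) = \<pi> ` {1..<p}"
  by simp

lemma set_word: "set (word n \<pi>) = \<pi> ` {1..n}"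
  by (auto simp: word_def)

lemma avoids_132_word: "avoids_132 (word n \<pi>) \<longleftrightarrow> \<not> contains_132 n \<pi>"
proof -
  have mem: "p \<in> {1..n} \<and> q \<in> {1..n} \<and> r \<in> {1..n} \<and> p < q \<and> q < r \<longleftrightarrow>
      q \<in> {1..n} \<and> p \<in> {1..<q} \<and> r \<in> {Suc q..<Suc n}" for p q r by auto
  have "avoids_132 (word n \<pi>) \<longleftrightarrow> (\<forall>q\<in>{1..n}. \<forall>a\<in>set (map \<pi> [1..<q]).
      \<forall>b\<in>set (map \<pi> [Suc q..<Suc n]). \<not> (a < b \<and> b < \<pi> q))"
    unfolding avoids_132_def word_eq_append_Cons_iff by blast
  also have "\<dots> \<longleftrightarrow>
      (\<forall>q\<in>{1..n}. \<forall>p\<in>{1..<q}. \<forall>r\<in>{Suc q..<Suc n}. \<not> (\<pi> p < \<pi> r \<and> \<pi> r < \<pi> q))"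
    unfolding set_map set_upt by blast
  also have "\<dots> \<longleftrightarrow> \<not> contains_132 n \<pi>"
    unfolding contains_132_def using mem by blast
  finally show ?thesis .
qed

lemma lr_minima_word: "lr_minima (word n \<pi>) = \<pi> ` lr_min_positions n \<pi>"
proof -
  have "lr_minima (word n \<pi>) = {x. \<exists>p\<in>{1..n}. x = \<pi> p \<and> (\<forall>y\<in>set (map \<pi> [1..<p]). x < y)}"
    unfolding lr_minima_def word_eq_append_Cons_iff by blast
  also have "\<dots> = \<pi> ` lr_min_positions n \<pi>"
    unfolding set_word_prefix lr_min_positions_def by blast
  finally show ?thesis .
qed

text \<open>Being a left-to-right minimum depends only on earlier entries, and the prefix before
  \<open>Suc p'\<close> is \<open>word p' \<pi>\<close>.\<close>

lemma lr_minima_word_prefix: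
  assumes "p \<in> {1..n}"
  shows "lr_minima (map \<pi> [1..<p]) = \<pi> ` {k \<in> lr_min_positions n \<pi>. k < p}"
proof -
  obtain p' where p: "p = Suc p'" using assms by (cases p) auto
  have "lr_min_positions p' \<pi> = {k \<in> lr_min_positions n \<pi>. k < p}"
    using assms p by (auto simp: lr_min_positions_def)
  then show ?thesis using lr_minima_word[of p' \<pi>] p by (simp add: word_def)
qed

section \<open>Boxes of a permutation described by its left-to-right minima\<close>

locale perm =
  fixes n :: nat and \<pi> :: "nat \<Rightarrow> nat"
  assumes perm: "\<pi> permutes {1..n}"
begin

abbreviation mins :: "nat set" where "mins \<equiv> lr_min_positions n \<pi>"

lemma mins_subset: "mins \<subseteq> {1..n}"
  by (auto simp: lr_min_positions_def)

lemma finite_mins: "finite mins"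
  using mins_subset finite_subset by blast

lemma inj: "\<pi> p = \<pi> q \<longleftrightarrow> p = q"
  using permutes_inj[OF perm] by (auto dest: injD)

lemma mins_decreasing: "k \<in> mins \<Longrightarrow> k' \<in> mins \<Longrightarrow> k < k' \<Longrightarrow> \<pi> k' < \<pi> k"
  by (auto simp: lr_min_positions_def)

lemma ex_min_below:
  assumes "p \<in> {1..n} - mins"
  shows "\<exists>k\<in>mins. k < p \<and> \<pi> k < \<pi> p"
proof -
  \<comment> \<open>Weak inequalities let a minimum be its own witness; from any other entry one
    moves to a smaller one on its left.\<close>
  have "p \<in> {1..n} \<Longrightarrow> \<exists>k\<in>mins. k \<le> p \<and> \<pi> k \<le> \<pi> p" for p
  proof (induction p rule: less_induct)
    case (less p)
    show ?case
    proof (cases "p \<in> mins")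
      case False
      then obtain q where q: "q \<in> {1..<p}" "\<pi> q \<le> \<pi> p"
        using less.prems by (auto simp: lr_min_positions_def not_less)
      then obtain k where "k \<in> mins" "k \<le> q" "\<pi> k \<le> \<pi> q" using less.IH[of q] less.prems by auto
      moreover from this have "k \<le> p" "\<pi> k \<le> \<pi> p" using q by auto
      ultimately show ?thesis by blast
    qed auto
  qed
  then obtain k where "k \<in> mins" "k \<le> p" "\<pi> k \<le> \<pi> p" using assms by blast
  then show ?thesis using assms inj by (metis DiffD2 le_neq_implies_less)
qed

lemma nonmin_iff:
  assumes "p \<in> {1..n}"
  shows "p \<notin> mins \<longleftrightarrow> (\<exists>y\<in>set (map \<pi> [1..<p]). y < \<pi> p)"
proof -
  have "p \<notin> mins \<longleftrightarrow> (\<exists>j\<in>{1..<p}. \<not> \<pi> p < \<pi> j)"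
    using assms unfolding lr_min_positions_def by blast
  also have "\<dots> \<longleftrightarrow> (\<exists>j\<in>{1..<p}. \<pi> j < \<pi> p)"
  proof (rule bex_cong[OF refl])
    fix j assume "j \<in> {1..<p}"
    then have "\<pi> j \<noteq> \<pi> p" using inj by simp
    then show "\<not> \<pi> p < \<pi> j \<longleftrightarrow> \<pi> j < \<pi> p" by linarith
  qed
  also have "\<dots> \<longleftrightarrow> (\<exists>y\<in>set (map \<pi> [1..<p]). y < \<pi> p)"
    unfolding set_word_prefix by blast
  finally show ?thesis .
qed

text \<open>For an entry that is not a minimum, \<open>card (col p)\<close> is the column of its box
  and, with \<open>above\<close> defined next, \<open>Suc (card (above p))\<close> is the
  row.\<close>

definition col :: "nat \<Rightarrow> nat set" where "col p = {k \<in> mins. k < p}"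

definition above :: "nat \<Rightarrow> nat set" where "above p = {k \<in> mins. \<pi> p < \<pi> k}"

lemma lr_min_pos_less_iff:
  assumes "1 \<le> j" "p \<in> {1..n}"
  shows "lr_min_pos n \<pi> j < p \<longleftrightarrow> j \<le> card (col p)"
proof (cases "j \<le> card mins")
  case True
  have "sorted_list_of_set mins ! (j - 1) \<in> mins"
    using True assms(1) finite_mins nth_mem[of "j - 1" "sorted_list_of_set mins"] by simp
  moreover have "sorted_list_of_set mins ! (j - 1) \<in> col p \<longleftrightarrow> j - 1 < card (col p)"
    using True assms(1) finite_mins by (intro sorted_list_of_set_nth_mem_iff) (auto simp: col_def)
  ultimately show ?thesis using True assms(1) by (auto simp: lr_min_pos_def lr_min_count_def col_def)
next
  \<comment> \<open>Here \<open>lr_min_pos\<close> is the default \<open>n + 1\<close>, which is not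
    before any position.\<close>
  case False
  moreover have "card (col p) \<le> card mins" using finite_mins by (intro card_mono) (auto simp: col_def)
  ultimately show ?thesis using assms by (auto simp: lr_min_pos_def lr_min_count_def)
qed

lemma lr_min_pos_in_mins: "1 \<le> j \<Longrightarrow> j \<le> card mins \<Longrightarrow> lr_min_pos n \<pi> j \<in> mins"
  using finite_mins nth_mem[of "j - 1" "sorted_list_of_set mins"]
  by (simp add: lr_min_pos_def lr_min_count_def)

text \<open>The minima decrease from left to right, so \<open>above p\<close> is an initial segment
  of \<open>mins\<close> in the order of positions.\<close>

lemma less_lr_min_val_iff:
  assumes "1 \<le> j" "j \<le> card mins"
  shows "\<pi> p < lr_min_val n \<pi> j \<longleftrightarrow> j \<le> card (above p)"
proof -
  have "lr_min_pos n \<pi> j \<in> above p \<longleftrightarrow> j - 1 < card (above p)"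
  proof -
    have "sorted_list_of_set mins ! (j - 1) \<in> above p \<longleftrightarrow> j - 1 < card (above p)"
      using assms finite_mins mins_decreasing
      by (intro sorted_list_of_set_nth_mem_iff) (fastforce simp: above_def)+
    then show ?thesis using assms by (simp add: lr_min_pos_def lr_min_count_def)
  qed
  then show ?thesis using assms lr_min_pos_in_mins[OF assms]
    by (auto simp: lr_min_val_def above_def)
qed

lemma in_box_iff:
  assumes "p \<in> {1..n}" "1 \<le> i" "i \<le> j" "j \<le> card mins"
  shows "(lr_min_pos n \<pi> j < p \<and> p < lr_min_pos n \<pi> (j + 1) \<and>
      lr_min_val n \<pi> i < \<pi> p \<and> \<pi> p < lr_min_val n \<pi> (i - 1)) \<longleftrightarrow>
     p \<notin> mins \<and> i = Suc (card (above p)) \<and> j = card (col p)" (is "?L \<longleftrightarrow> ?R")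
proof -
  have le: "\<pi> p \<le> n" using perm assms(1) by (metis atLeastAtMost_iff permutes_in_image)
  have lo: "\<pi> p < lr_min_val n \<pi> (i - 1) \<longleftrightarrow> i - 1 \<le> card (above p)"
  proof (cases "i = 1")
    \<comment> \<open>The convention that row 1 is bounded above by \<open>n + 1\<close>.\<close>
    case True
    then show ?thesis using le by (simp add: lr_min_val_def)
  next
    case False
    then show ?thesis using assms by (intro less_lr_min_val_iff) auto
  qed
  have hi: "\<pi> p < lr_min_val n \<pi> i \<longleftrightarrow> i \<le> card (above p)"
    using assms by (intro less_lr_min_val_iff) auto
  have j1: "lr_min_pos n \<pi> j < p \<longleftrightarrow> j \<le> card (col p)"
    using assms by (intro lr_min_pos_less_iff) auto
  have j2: "lr_min_pos n \<pi> (j + 1) < p \<longleftrightarrow> j + 1 \<le> card (col p)"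
    using assms by (intro lr_min_pos_less_iff) auto
  show ?thesis
  proof (cases "p \<in> mins")
    case True
    have "\<not> ?L"
    proof
      assume L: ?L
      have card: "card (col p) = j" using L j1 j2 by auto
      \<comment> \<open>For a minimum, the larger minima are exactly the earlier ones. The row
        condition would then give \<open>j < i\<close>, outside the staircase.\<close>
      have "above p = col p"
        using True mins_decreasing inj unfolding above_def col_def
        by (auto) (metis linorder_neqE_nat less_asym less_irrefl)+
      then show False using L hi card assms(3) by auto
    qed
    then show ?thesis using True by blast
  next
    case False
    have ne: "\<pi> p \<noteq> lr_min_val n \<pi> i"
      using False lr_min_pos_in_mins[of i] assms inj by (auto simp: lr_min_val_def)
    have ne': "p \<noteq> lr_min_pos n \<pi> (j + 1)"
    proof (cases "j + 1 \<le> card mins")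
      case True
      then show ?thesis using False lr_min_pos_in_mins[of "j + 1"] by auto
    next
      case False
      then show ?thesis using assms by (auto simp: lr_min_pos_def lr_min_count_def)
    qed
    have hi': "lr_min_val n \<pi> i < \<pi> p \<longleftrightarrow> card (above p) < i" using hi ne by linarith
    have j2': "p < lr_min_pos n \<pi> (j + 1) \<longleftrightarrow> card (col p) < j + 1" using j2 ne' by linarith
    show ?thesis unfolding lo hi' j1 j2' using False assms(2) by auto
  qed
qed

lemma nonzero_boxes_eq:
  "nonzero_boxes n \<pi> = (\<lambda>p. (Suc (card (above p)), card (col p))) ` ({1..n} - mins)"
proof -
  have box: "(i, j) \<in> nonzero_boxes n \<pi> \<longleftrightarrow> 1 \<le> i \<and> i \<le> j \<and> j \<le> card mins \<and>
      (\<exists>p\<in>{1..n} - mins. i = Suc (card (above p)) \<and> j = card (col p))" for i j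
  proof -
    have "staircase_encoding n \<pi> (i, j) \<noteq> 0 \<longleftrightarrow> (\<exists>p\<in>{1..n}. p \<notin> mins \<and>
        i = Suc (card (above p)) \<and> j = card (col p))" if "1 \<le> i" "i \<le> j" "j \<le> card mins"
    proof -
      have "{p \<in> {1..n}. lr_min_pos n \<pi> j < p \<and> p < lr_min_pos n \<pi> (j + 1) \<and>
          lr_min_val n \<pi> i < \<pi> p \<and> \<pi> p < lr_min_val n \<pi> (i - 1)} =
        {p \<in> {1..n}. p \<notin> mins \<and> i = Suc (card (above p)) \<and> j = card (col p)}"
        using in_box_iff[OF _ that] by blast
      then have "staircase_encoding n \<pi> (i, j) =
          card {p \<in> {1..n}. p \<notin> mins \<and> i = Suc (card (above p)) \<and> j = card (col p)}"
        unfolding staircase_encoding_def by simp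
      then show ?thesis by (auto simp: card_eq_0_iff)
    qed
    then show ?thesis
      unfolding nonzero_boxes_def staircase_grid_def lr_min_count_def by auto
  qed
  \<comment> \<open>The box lies in the staircase: a minimum \<open>k\<close> before and below
    \<open>p\<close> belongs to \<open>col p\<close> but not to \<open>above p\<close>, and every
    minimum in \<open>above p\<close> precedes \<open>k\<close>.\<close>
  have bound: "Suc (card (above p)) \<le> card (col p) \<and> card (col p) \<le> card mins"
    if p: "p \<in> {1..n} - mins" for p
  proof
    obtain k where k: "k \<in> mins" "k < p" "\<pi> k < \<pi> p" using ex_min_below[OF p] by blast
    have "k' < k" if "k' \<in> above p" for k'
    proof -
      have "k' \<in> mins" "\<pi> k < \<pi> k'" using that k unfolding above_def by auto
      then show ?thesis using k(1) mins_decreasing[of k k'] by (metis less_asym linorder_neqE_nat less_irrefl)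
    qed
    moreover have "above p \<subseteq> mins" by (auto simp: above_def)
    ultimately have "above p \<subseteq> col p" using k(2) by (force simp: col_def)
    moreover have "k \<in> col p" "k \<notin> above p" using k by (auto simp: col_def above_def)
    ultimately have "above p \<subset> col p" by blast
    moreover have "finite (col p)" using finite_mins by (simp add: col_def)
    ultimately show "Suc (card (above p)) \<le> card (col p)" using psubset_card_mono Suc_leI by metis
    show "card (col p) \<le> card mins" using finite_mins by (intro card_mono) (auto simp: col_def)
  qed
  show ?thesis
  proof (intro equalityI subrelI)
    fix i j assume "(i, j) \<in> nonzero_boxes n \<pi>"
    then show "(i, j) \<in> (\<lambda>p. (Suc (card (above p)), card (col p))) ` ({1..n} - mins)"
      unfolding box by blast
  next
    fix i j assume "(i, j) \<in> (\<lambda>p. (Suc (card (above p)), card (col p))) ` ({1..n} - mins)"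
    then obtain p where p: "p \<in> {1..n} - mins" "i = Suc (card (above p))" "j = card (col p)"
      by blast
    then show "(i, j) \<in> nonzero_boxes n \<pi>" unfolding box using bound[OF p(1)] by auto
  qed
qed

lemma word_boxes_eq:
  "word_boxes (word n \<pi>) = (\<lambda>p. (\<pi> ` col p, \<pi> ` (mins - above p))) ` ({1..n} - mins)"
proof -
  have row: "{m \<in> \<pi> ` mins. m < \<pi> p} = \<pi> ` (mins - above p)" if "p \<notin> mins" for p
  proof -
    have "\<pi> k \<noteq> \<pi> p" if "k \<in> mins" for k using that \<open>p \<notin> mins\<close> inj by auto
    then show ?thesis unfolding above_def by (auto simp: not_less le_less)
  qed
  have "word_boxes (word n \<pi>) = {(lr_minima (map \<pi> [1..<p]), {m \<in> \<pi> ` mins. m < \<pi> p}) | p.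
      p \<in> {1..n} \<and> (\<exists>y\<in>set (map \<pi> [1..<p]). y < \<pi> p)}"
    unfolding word_boxes_def word_eq_append_Cons_iff lr_minima_word by blast
  also have "\<dots> = (\<lambda>p. (lr_minima (map \<pi> [1..<p]), {m \<in> \<pi> ` mins. m < \<pi> p})) ` ({1..n} - mins)"
    using nonmin_iff by blast
  also have "\<dots> = (\<lambda>p. (\<pi> ` col p, \<pi> ` (mins - above p))) ` ({1..n} - mins)"
    by (intro image_cong refl) (simp add: lr_minima_word_prefix row col_def del: One_nat_def)
  finally show ?thesis .
qed

text \<open>The sets \<open>col p\<close> form a chain, and so do the sets \<open>above p\<close>.
  Hence their cardinalities determine them, and numerical boxes and pairs of sets identify the same
  entries.\<close>

lemma card_nonzero_boxes: "card (nonzero_boxes n \<pi>) = card (word_boxes (word n \<pi>))"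
  unfolding nonzero_boxes_eq word_boxes_eq
proof (rule card_image_eq_if_same_fibres)
  fix p q
  have img: "\<pi> ` X = \<pi> ` Y \<longleftrightarrow> X = Y" for X Y
    using permutes_inj[OF perm] by (simp add: inj_image_eq_iff)
  have fin: "finite (col p)" "finite (col q)" "finite (above p)" "finite (above q)"
    using finite_mins by (auto simp: col_def above_def)
  have "col p \<subseteq> col q \<or> col q \<subseteq> col p" by (auto simp: col_def)
  then have 1: "card (col p) = card (col q) \<longleftrightarrow> col p = col q"
    using fin card_subset_eq by metis
  have "above p \<subseteq> above q \<or> above q \<subseteq> above p" by (auto simp: above_def)
  then have 2: "card (above p) = card (above q) \<longleftrightarrow> above p = above q"
    using fin card_subset_eq by metis
  have "mins - above p = mins - above q \<longleftrightarrow> above p = above q" by (auto simp: above_def)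
  then show "(Suc (card (above p)), card (col p)) = (Suc (card (above q)), card (col q)) \<longleftrightarrow>
      (\<pi> ` col p, \<pi> ` (mins - above p)) = (\<pi> ` col q, \<pi> ` (mins - above q))"
    using 1 2 img by auto
qed

end

section \<open>From permutations to trees\<close>

lemma word_inj_on: "inj_on (word n) {\<pi>. \<pi> permutes {1..n}}"
proof (rule inj_onI)
  fix \<pi> \<sigma> assume p: "\<pi> \<in> {\<pi>. \<pi> permutes {1..n}}" "\<sigma> \<in> {\<pi>. \<pi> permutes {1..n}}"
    and w: "word n \<pi> = word n \<sigma>"
  have "\<pi> x = \<sigma> x" for x
  proof (cases "x \<in> {1..n}")
    case True
    then show ?thesis using w by (auto simp: word_def)
  next
    case False
    then show ?thesis using p by (auto simp: permutes_def)
  qed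
  then show "\<pi> = \<sigma>" by blast
qed

lemma ex_perm_of_word:
  assumes "set w = {1..length w}"
  shows "\<exists>\<pi>. \<pi> permutes {1..length w} \<and> word (length w) \<pi> = w"
proof -
  let ?n = "length w"
  \<comment> \<open>List indices start at 0, and \<open>permutes\<close> requires the identity
    outside \<open>{1..length w}\<close>.\<close>
  define \<pi> where "\<pi> p = (if p \<in> {1..?n} then w ! (p - 1) else p)" for p
  have w: "word ?n \<pi> = w" by (rule nth_equalityI) (auto simp: word_def \<pi>_def simp del: upt_Suc)
  then have "\<pi> ` {1..?n} = {1..?n}" using set_word[of ?n \<pi>] assms by simp
  then have "bij_betw \<pi> {1..?n} {1..?n}"
    by (simp add: bij_betw_def finite_surj_inj)
  then have "\<pi> permutes {1..?n}" by (rule bij_imp_permutes) (simp only: \<pi>_def if_False)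
  then show ?thesis using w by blast
qed

lemma word_image_avoiders:
  "word n ` {\<pi>. \<pi> permutes {1..n} \<and> \<not> contains_132 n \<pi>} = word_of 0 ` {t. size t = n}"
proof (intro equalityI subsetI)
  fix w assume "w \<in> word n ` {\<pi>. \<pi> permutes {1..n} \<and> \<not> contains_132 n \<pi>}"
  then obtain \<pi> where p: "\<pi> permutes {1..n}" "\<not> contains_132 n \<pi>" and w: "w = word n \<pi>" by blast
  have len: "length w = n" by (simp add: w word_def)
  have "set w = {1..n}" using p w by (simp add: set_word permutes_image)
  moreover from this have "distinct w" using len by (simp add: card_distinct)
  moreover have "{1..n} = {0<..0 + length w}" using len by auto
  moreover have "avoids_132 w" using p w avoids_132_word by blast
  ultimately obtain t where t: "w = word_of 0 t"
    using word_of_surj[of w 0] by metis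
  then have "size t = n" using len by simp
  then show "w \<in> word_of 0 ` {t. size t = n}" using t by blast
next
  fix w assume "w \<in> word_of 0 ` {t. size t = n}"
  then obtain t where t: "w = word_of 0 t" "size t = n" by blast
  then have len: "length w = n" by simp
  then have "set w = {1..length w}" using t by (auto simp: set_word_of)
  then obtain \<pi> where p: "\<pi> permutes {1..n}" "w = word n \<pi>" using ex_perm_of_word len by metis
  have "avoids_132 w" unfolding t(1) by (rule avoids_132_word_of)
  then have "\<not> contains_132 n \<pi>" unfolding p(2) avoids_132_word .
  then show "w \<in> word n ` {\<pi>. \<pi> permutes {1..n} \<and> \<not> contains_132 n \<pi>}"
    using p by blast
qed

text \<open>Avoiding permutations and trees are injected into the same set of words, and the number
  of boxes can be read off the word.\<close>

lemma J_eq_card_trees: "J n k = card {t. size t = n \<and> box_count t = k}"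
proof -
  let ?P = "{\<pi>. \<pi> permutes {1..n} \<and> \<not> contains_132 n \<pi>}"
  let ?K = "{\<pi>. \<pi> permutes {1..n} \<and> \<not> contains_132 n \<pi> \<and> card (nonzero_boxes n \<pi>) = k}"
  have K: "?K = {\<pi> \<in> ?P. card (word_boxes (word n \<pi>)) = k}"
    by (auto simp: perm.card_nonzero_boxes perm_def)
  have "J n k = card (word n ` ?K)"
    unfolding J_def by (rule card_image[symmetric], rule inj_on_subset[OF word_inj_on]) auto
  also have "word n ` ?K = {w \<in> word n ` ?P. card (word_boxes w) = k}"
    unfolding K by blast
  also have "\<dots> = word_of 0 ` {t. size t = n \<and> box_count t = k}"
    unfolding word_image_avoiders by (auto simp: card_word_boxes_word_of)
  also have "card \<dots> = card {t. size t = n \<and> box_count t = k}"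
    by (rule card_image) (auto simp: inj_on_def dest: word_of_inj)
  finally show ?thesis .
qed

theorem theorem2p8:
  fixes i :: nat
  shows "J (3 * i + 2) (2 * i + 1) > 0 \<and>
         real (J (3 * i + 2) (2 * i + 1)) = 1 / (real i + 1) * real ((2 * i) choose i)"
proof -
  have "J (3 * i + 2) (2 * i + 1) = card {s :: btree. size s = i}"
    unfolding J_eq_card_trees extremal_trees
    by (rule card_image) (auto simp: inj_on_def dest: thicken_inj)
  then have eq: "real (J (3 * i + 2) (2 * i + 1)) = central_binomial i / (real i + 1)"
    by (simp add: card_trees)
  moreover have "(2 * i) choose i > 0" by simp
  ultimately have "real (J (3 * i + 2) (2 * i + 1)) > 0" by simp
  then show ?thesis using eq by simp
qed

end
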